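(* Let $\Delta\neq\mathbb{N}$ be a numerical semigroup, let $d\ge2$ be an integer, and let $a\in\Delta\setminus\{0\}$ with $a+1\in\Delta$. Set $\Delta_d(a)=d\Delta\cup\bigcup_{i=1}^{d-1}(da+i+d\Delta)$, which is a numerical semigroup. If $\Delta$ satisfies Wilf's inequality $\operatorname{e}(\Delta)\operatorname{n}(\Delta)\ge\operatorname{c}(\Delta)$, then $\Delta_d(a)$ satisfies Wilf's inequality as well, i.e. $\operatorname{e}(\Delta_d(a))\operatorname{n}(\Delta_d(a))\ge\operatorname{c}(\Delta_d(a))$.
   Context: $\mathbb{N}=\{0,1,2,\dots\}$. A numerical semigroup is a submonoid of $(\mathbb{N},+)$ with finite complement in $\mathbb{N}$. For a numerical semigroup $S$: $\operatorname{F}(S)=\max(\mathbb{Z}\setminus S)$ is the Frobenius number, $\operatorname{c}(S)=\operatorname{F}(S)+1$ is the conductor, $\operatorname{n}(S)=|\{s\in S: s<\operatorname{F}(S)\}|$, and $\operatorname{e}(S)$ (embedding dimension) is the cardinality of the unique minimal system of generators of $S$. $dA=\{dx: x\in A\}$ and $k+A=\{k+x:x\in A\}$ for $A\subseteq\mathbb{N}$ and $k\in\mathbb{N}$. *)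

theory Defs
  imports Complex_Main "HOL-Library.Set_Algebras"
begin

definition submonoid :: "nat set \<Rightarrow> bool" where
  "submonoid S \<longleftrightarrow> 0 \<in> S \<and> (\<forall>x\<in>S. \<forall>y\<in>S. x + y \<in> S)"

definition numerical_semigroup :: "nat set \<Rightarrow> bool" where
  "numerical_semigroup S \<longleftrightarrow> submonoid S \<and> finite (UNIV - S)"

text \<open>
  The maximum is taken over the integers outside \<open>S\<close>, so that the Frobenius number of
  \<open>UNIV\<close> is \<open>-1\<close>. That set is infinite (unbounded below), hence \<open>GREATEST\<close> rather than \<open>Max\<close>.
\<close>
definition frobenius :: "nat set \<Rightarrow> int" where
  "frobenius S = (GREATEST z. z \<notin> int ` S)"

definition conductor :: "nat set \<Rightarrow> int" where
  "conductor S = frobenius S + 1"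

definition n_left :: "nat set \<Rightarrow> nat" where
  "n_left S = card {s \<in> S. int s < frobenius S}"

text \<open>\<open>submonoid hull A\<close> is the submonoid of the naturals generated by \<open>A\<close>.\<close>
definition generates :: "nat set \<Rightarrow> nat set \<Rightarrow> bool" where
  "generates A S \<longleftrightarrow> submonoid hull A = S"

text \<open>Minimality is with respect to inclusion.\<close>
definition minimal_generators :: "nat set \<Rightarrow> nat set \<Rightarrow> bool" where
  "minimal_generators A S \<longleftrightarrow> generates A S \<and> (\<forall>B. B \<subset> A \<longrightarrow> \<not> generates B S)"

definition embedding_dim :: "nat set \<Rightarrow> nat" where
  "embedding_dim S = card (THE A. minimal_generators A S)"

definition wilf :: "nat set \<Rightarrow> bool" where
  "wilf S \<longleftrightarrow> int (embedding_dim S * n_left S) \<ge> conductor S"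

definition dilated_extension :: "nat set \<Rightarrow> nat \<Rightarrow> nat \<Rightarrow> nat set" where
  "dilated_extension \<Delta> d a = (d *o \<Delta>) \<union> (\<Union>i\<in>{1..d - 1}. (d * a + i) +o (d *o \<Delta>))"

end

theory Submission
  imports Defs
begin

text \<open>
  Write \<open>S\<close> for the dilated extension and \<open>c\<close>, \<open>n\<close>, \<open>e\<close> for the conductor, the number of
  small elements and the embedding dimension of \<open>\<Delta>\<close>. Splitting \<open>S\<close> into residue classes modulo
  \<open>d\<close> shows that its conductor is \<open>d (a + c)\<close> and that it has \<open>d n + a\<close> small elements.
  The minimal generators of a submonoid are its irreducible elements; those of \<open>S\<close> are
  the \<open>d g\<close> with \<open>g\<close> irreducible in \<open>\<Delta>\<close>, together with \<open>d a + 1, \<dots>, d a + (d - 1)\<close>, so the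
  embedding dimension of \<open>S\<close> is \<open>e + d - 1\<close>. Then \<open>e n \<ge> c\<close> and \<open>e \<ge> 1\<close> give
  \<open>(e + d - 1) (d n + a) \<ge> d e n + d a \<ge> d (a + c)\<close>.
\<close>

section \<open>Minimal generators as irreducible elements\<close>

definition irreducibles :: "nat set \<Rightarrow> nat set" where
  "irreducibles S = {x \<in> S. x \<noteq> 0 \<and> (\<forall>y\<in>S. \<forall>z\<in>S. x = y + z \<longrightarrow> y = 0 \<or> z = 0)}"

lemma submonoid_hull: "submonoid (submonoid hull A)"
  by (auto simp: hull_def submonoid_def)

text \<open>A nonzero element of \<open>S\<close> that is not irreducible splits into two nonzero,
  hence strictly smaller, elements of \<open>S\<close>, so strong induction applies.\<close>

lemma generates_irreducibles:
  assumes "submonoid S"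
  shows "generates (irreducibles S) S"
proof -
  let ?H = "submonoid hull irreducibles S"
  have "?H \<subseteq> S"
    by (rule hull_minimal) (auto simp: irreducibles_def assms)
  moreover have "x \<in> S \<Longrightarrow> x \<in> ?H" for x
  proof (induction x rule: less_induct)
    case (less x)
    consider "x = 0" | "x \<in> irreducibles S"
      | y z where "y \<in> S" "z \<in> S" "x = y + z" "y \<noteq> 0" "z \<noteq> 0"
      using less.prems unfolding irreducibles_def by blast
    then show ?case
    proof cases
      case 1
      then show ?thesis using submonoid_hull unfolding submonoid_def by blast
    next
      case 2
      then show ?thesis by (rule hull_inc)
    next
      case 3
      then have "y \<in> ?H" "z \<in> ?H" using less.IH by auto
      then show ?thesis using submonoid_hull 3(3) unfolding submonoid_def by blast
    qed
  qed
  ultimately show ?thesis unfolding generates_def by blast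
qed

text \<open>Deleting an irreducible \<open>x\<close> leaves a submonoid, since no sum of two other
  elements equals \<open>x\<close>. A generating set that misses \<open>x\<close> would therefore
  generate only a part of \<open>S - {x}\<close>.\<close>

lemma irreducibles_subset_generators:
  assumes "generates A S"
  shows "irreducibles S \<subseteq> A"
proof
  fix x assume x: "x \<in> irreducibles S"
  have S: "submonoid hull A = S" using assms by (simp add: generates_def)
  have "submonoid S" using submonoid_hull[of A] S by simp
  then have "submonoid (S - {x})"
    using x by (fastforce simp: submonoid_def irreducibles_def)
  then have "S \<subseteq> S - {x}" if "x \<notin> A"
    using that hull_subset[of A submonoid] hull_minimal[of A "S - {x}" submonoid]
    unfolding S by blast
  then show "x \<in> A" using x by (auto simp: irreducibles_def)
qed

text \<open>The irreducibles generate \<open>S\<close> and lie in every generating set, so they form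
  the one minimal generating set and the definite description in \<open>embedding_dim\<close>
  denotes them.\<close>

lemma embedding_dim_eq_card_irreducibles:
  assumes "submonoid S"
  shows "embedding_dim S = card (irreducibles S)"
proof -
  have "minimal_generators A S \<longleftrightarrow> A = irreducibles S" for A
    unfolding minimal_generators_def
    using generates_irreducibles[OF assms] irreducibles_subset_generators by blast
  then show ?thesis by (simp add: embedding_dim_def)
qed

section \<open>Invariants read off from the largest gap\<close>

lemma frobenius_eqI:
  assumes "f \<notin> S" and "\<And>x. f < x \<Longrightarrow> x \<in> S"
  shows "frobenius S = int f"
  unfolding frobenius_def
proof (rule Greatest_equality)
  show "int f \<notin> int ` S" using assms(1) by auto
next
  fix z :: int assume z: "z \<notin> int ` S"
  show "z \<le> int f"
  proof (rule ccontr)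
    assume "\<not> z \<le> int f"
    then have "z = int (nat z)" "nat z \<in> S" using assms(2) by auto
    then show False using z by blast
  qed
qed

lemma conductor_eqI:
  assumes "f \<notin> S" and "\<And>x. f < x \<Longrightarrow> x \<in> S"
  shows "conductor S = int (Suc f)"
  using frobenius_eqI[OF assms] by (simp add: conductor_def)

text \<open>The gap \<open>f\<close> is not itself an element, so counting below the conductor gives
  the same number as counting below the Frobenius number.\<close>

lemma n_left_eqI:
  assumes "f \<notin> S" and "\<And>x. f < x \<Longrightarrow> x \<in> S"
  shows "n_left S = card {s \<in> S. s < Suc f}"
proof -
  have "{s \<in> S. int s < frobenius S} = {s \<in> S. s < Suc f}"
    using assms(1) by (auto simp: frobenius_eqI[OF assms] less_Suc_eq)
  then show ?thesis by (simp add: n_left_def)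
qed

section \<open>Residue classes modulo \<open>d\<close> and closure under addition\<close>

text \<open>By uniqueness of quotient and remainder, each component of the union occupies a single
  residue class. This reduces membership to a question about quotients in \<Delta>.\<close>

lemma in_dilated_extension_iff:
  assumes "i < d"
  shows "d * q + i \<in> dilated_extension \<Delta> d a \<longleftrightarrow>
    (if i = 0 then q \<in> \<Delta> else \<exists>y\<in>\<Delta>. q = a + y)"
proof -
  have split: "d * q + i = d * p + j \<longleftrightarrow> q = p \<and> i = j" if "j < d" for p j
    using assms that
    by (metis add_right_cancel div_mult_self4 div_less add_0_right mod_mult_self4 mod_less
        less_nat_zero_code)
  have "d * q + i \<in> d *o \<Delta> \<longleftrightarrow> i = 0 \<and> q \<in> \<Delta>"
    using split[of 0] assms by (auto simp: elt_set_times_def)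
  moreover have residue: "d * q + i \<in> (d * a + j) +o (d *o \<Delta>) \<longleftrightarrow> i = j \<and> (\<exists>y\<in>\<Delta>. q = a + y)"
    if "j < d" for j
  proof -
    have "d * q + i \<in> (d * a + j) +o (d *o \<Delta>) \<longleftrightarrow> (\<exists>y\<in>\<Delta>. d * q + i = d * (a + y) + j)"
      by (auto simp: elt_set_times_def elt_set_plus_def distrib_left add_ac)
    then show ?thesis unfolding split[OF that] by blast
  qed
  moreover have "(\<exists>j\<in>{1..d - 1}. d * q + i \<in> (d * a + j) +o (d *o \<Delta>)) \<longleftrightarrow>
      (\<exists>j\<in>{1..d - 1}. i = j \<and> (\<exists>y\<in>\<Delta>. q = a + y))"
    using assms by (intro bex_cong refl residue) auto
  moreover have "i \<in> {1..d - 1} \<longleftrightarrow> i \<noteq> 0" using assms by auto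
  ultimately show ?thesis
    unfolding dilated_extension_def Un_iff UN_iff by auto
qed

lemma dilated_extension_cases:
  assumes "x \<in> dilated_extension \<Delta> d a"
  obtains y where "y \<in> \<Delta>" "x = d * y"
    | y i where "y \<in> \<Delta>" "1 \<le> i" "i < d" "x = d * (a + y) + i"
  using assms unfolding dilated_extension_def
  by (fastforce simp: elt_set_times_def elt_set_plus_def algebra_simps)

lemma dilated_extension_mult:
  assumes "0 < d" "y \<in> \<Delta>"
  shows "d * y \<in> dilated_extension \<Delta> d a"
  using in_dilated_extension_iff[of 0 d y] assms by simp

lemma dilated_extension_residue:
  assumes "i < d" "1 \<le> i" "y \<in> \<Delta>"
  shows "d * (a + y) + i \<in> dilated_extension \<Delta> d a"
  using in_dilated_extension_iff[of i d "a + y"] assms by auto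

text \<open>When two nonzero residues are added, one shift \<open>a\<close> is kept and the other is
  absorbed into \<Delta>. If the residues overflow \<open>d\<close>, the carry turns the absorbed
  \<open>a\<close> into \<open>a + 1\<close>, which also lies in \<Delta>.\<close>

lemma submonoid_dilated_extension:
  assumes \<Delta>: "submonoid \<Delta>" and d: "0 < d" and a: "a \<in> \<Delta>" "a + 1 \<in> \<Delta>"
  shows "submonoid (dilated_extension \<Delta> d a)"
proof -
  let ?S = "dilated_extension \<Delta> d a"
  have add: "u + v \<in> \<Delta>" if "u \<in> \<Delta>" "v \<in> \<Delta>" for u v
    using \<Delta> that by (simp add: submonoid_def)
  have "0 \<in> \<Delta>" using \<Delta> by (simp add: submonoid_def)
  then have "0 \<in> ?S" using dilated_extension_mult[OF d, of 0] by simp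
  moreover have "x + z \<in> ?S" if "x \<in> ?S" "z \<in> ?S" for x z
    using that(1)
  proof (cases rule: dilated_extension_cases)
    case (1 y)
    note x = this
    show ?thesis using that(2)
    proof (cases rule: dilated_extension_cases)
      case (1 w)
      then show ?thesis
        using x dilated_extension_mult[OF d add[OF x(1) 1(1)]] by (simp add: distrib_left)
    next
      case (2 w j)
      then show ?thesis
        using x dilated_extension_residue[OF 2(3,2) add[OF x(1) 2(1)]]
        by (simp add: algebra_simps)
    qed
  next
    case (2 y i)
    note x = this
    show ?thesis using that(2)
    proof (cases rule: dilated_extension_cases)
      case (1 w)
      then show ?thesis
        using x dilated_extension_residue[OF x(3,2) add[OF x(1) 1(1)]]
        by (simp add: algebra_simps)
    next
      case (2 w j)
      show ?thesis
      proof (cases "i + j < d")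
        case True
        have "d * (a + (a + (y + w))) + (i + j) \<in> ?S"
          using True x(2) by (intro dilated_extension_residue add a x(1) 2(1)) auto
        then show ?thesis using x(4) 2(4) by (simp add: algebra_simps)
      next
        case False
        define k where "k = i + j - d"
        have k: "i + j = d + k" "k < d" using False x(3) 2(3) by (auto simp: k_def)
        have xz: "x + z = d * (a + ((a + 1) + (y + w))) + k"
          using x(4) 2(4) k(1) by (simp add: algebra_simps)
        \<comment> \<open>The new residue \<open>k\<close> may vanish or not: the first fact serves
          \<open>k \<noteq> 0\<close>, where the quotient must lie in \<open>a\<close> plus
          \<Delta>, and the second serves \<open>k = 0\<close>, where it must lie in
          \<Delta>.\<close>
        have "(a + 1) + (y + w) \<in> \<Delta>" by (intro add a x(1) 2(1))
        moreover from this have "a + ((a + 1) + (y + w)) \<in> \<Delta>" by (rule add[OF a(1)])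
        ultimately show ?thesis unfolding xz in_dilated_extension_iff[OF k(2)]
          by (simp only: split: if_split) blast
      qed
    qed
  qed
  ultimately show ?thesis by (simp add: submonoid_def)
qed

section \<open>Largest gap and number of small elements\<close>

text \<open>The largest missing quotient is \<open>a + f\<close> in a nonzero class and only
  \<open>f\<close> in class 0. The last gap thus sits in the top class \<open>d - 1\<close>, which
  is nonzero because \<open>d \<ge> 2\<close>.\<close>

lemma dilated_extension_Frobenius:
  assumes d: "d \<ge> 2" and f: "f \<notin> \<Delta>" "\<And>x. f < x \<Longrightarrow> x \<in> \<Delta>"
  shows "d * (a + f) + (d - 1) \<notin> dilated_extension \<Delta> d a"
    and "d * (a + f) + (d - 1) < x \<Longrightarrow> x \<in> dilated_extension \<Delta> d a"
proof -
  show "d * (a + f) + (d - 1) \<notin> dilated_extension \<Delta> d a"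
    using in_dilated_extension_iff[of "d - 1" d "a + f" \<Delta> a] f d by auto
next
  assume x: "d * (a + f) + (d - 1) < x"
  then have "d * Suc (a + f) \<le> x" using d by simp
  then have "d * Suc (a + f) div d \<le> x div d" by (rule div_le_mono)
  then have "a + f < x div d" using d by (simp del: mult_Suc_right)
  then have "x div d \<in> \<Delta>" "x div d = a + (x div d - a)" "x div d - a \<in> \<Delta>"
    using f(2) by auto
  then show "x \<in> dilated_extension \<Delta> d a"
    using in_dilated_extension_iff[of "x mod d" d "x div d" \<Delta> a] d
    by (simp split: if_splits) blast
qed

text \<open>With \<open>n\<close> elements of \<Delta> below \<open>c\<close>, class 0 contributes
  \<open>n + a\<close>, since all \<open>a\<close> quotients from \<open>c\<close> up to
  \<open>a + c - 1\<close> lie in \<Delta>. Each of the other \<open>d - 1\<close> classes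
  contributes \<open>n\<close>, as its quotients are shifted by \<open>a\<close>.\<close>

lemma card_dilated_extension_below:
  assumes d: "0 < d" and c: "\<And>x. c \<le> x \<Longrightarrow> x \<in> \<Delta>"
  shows "card {s \<in> dilated_extension \<Delta> d a. s < d * (a + c)} = d * card {s \<in> \<Delta>. s < c} + a"
proof -
  let ?N = "{s \<in> \<Delta>. s < c}"
  let ?g = "\<lambda>(y, i). d * (a + y) + i"
  let ?A = "(*) d ` (?N \<union> {c..<a + c})" and ?B = "?g ` (?N \<times> {1..<d})"
  have g: "?g (y, i) div d = a + y" "?g (y, i) mod d = i" if "i < d" for y i
    using that by auto
  have "{s \<in> dilated_extension \<Delta> d a. s < d * (a + c)} = ?A \<union> ?B"
  proof (intro equalityI subsetI)
    fix s assume "s \<in> {s \<in> dilated_extension \<Delta> d a. s < d * (a + c)}"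
    then have s: "s \<in> dilated_extension \<Delta> d a" "s < d * (a + c)" by auto
    from s(1) show "s \<in> ?A \<union> ?B"
    proof (cases rule: dilated_extension_cases)
      case (1 y)
      then show ?thesis using s(2) d by (force simp: not_less)
    next
      case (2 y i)
      then have "d * (a + y) < d * (a + c)" using s(2) by linarith
      then have "(y, i) \<in> ?N \<times> {1..<d}" using 2 by auto
      then have "?g (y, i) \<in> ?B" by (rule imageI)
      then show ?thesis using 2(4) by simp
    qed
  next
    fix s assume "s \<in> ?A \<union> ?B"
    then show "s \<in> {s \<in> dilated_extension \<Delta> d a. s < d * (a + c)}"
    proof
      assume "s \<in> ?A"
      then show ?thesis using d c by (auto intro: dilated_extension_mult)
    next
      assume "s \<in> ?B"
      then obtain y i where yi: "y \<in> \<Delta>" "y < c" "1 \<le> i" "i < d" "s = d * (a + y) + i" by auto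
      then have "s < d * Suc (a + y)" by simp
      also have "\<dots> \<le> d * (a + c)" using yi(2) by (intro mult_le_mono2) simp
      finally show ?thesis using yi by (simp add: dilated_extension_residue)
    qed
  qed
  moreover have "?A \<inter> ?B = {}"
  proof (rule Int_emptyI)
    fix u assume u: "u \<in> ?A" "u \<in> ?B"
    have "u mod d = 0" using u(1) by (elim imageE) simp
    moreover have "u mod d \<noteq> 0" using u(2) by auto
    ultimately show False by simp
  qed
  moreover have "card ?A = card ?N + a"
  proof -
    have "card ?A = card (?N \<union> {c..<a + c})"
      using d by (intro card_image) (simp add: inj_on_def)
    also have "\<dots> = card ?N + a" by (subst card_Un_disjoint) auto
    finally show ?thesis .
  qed
  moreover have "card ?B = card ?N * (d - 1)"
  proof -
    have "inj_on ?g (?N \<times> {1..<d})"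
    proof (rule inj_onI)
      fix p q assume pq: "p \<in> ?N \<times> {1..<d}" "q \<in> ?N \<times> {1..<d}" "?g p = ?g q"
      obtain y i where p: "p = (y, i)" "i < d" using pq(1) by auto
      obtain z j where q: "q = (z, j)" "j < d" using pq(2) by auto
      have "a + y = a + z" "i = j"
        using g[of i y] g[of j z] pq(3) p q by metis+
      then show "p = q" using p q by simp
    qed
    then show ?thesis by (simp add: card_image card_cartesian_product)
  qed
  ultimately have "card {s \<in> dilated_extension \<Delta> d a. s < d * (a + c)}
      = card ?N + a + card ?N * (d - 1)"
    by (simp add: card_Un_disjoint)
  also have "\<dots> = d * card ?N + a" using d by (cases d) (auto simp: algebra_simps)
  finally show ?thesis .
qed

section \<open>Irreducible elements of the dilated extension\<close>

lemma irreducibles_dilated_extension: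
  assumes \<Delta>: "submonoid \<Delta>" and d: "0 < d" and a: "a \<in> \<Delta>" "a + 1 \<in> \<Delta>" "a \<noteq> 0"
  shows "irreducibles (dilated_extension \<Delta> d a)
    = (*) d ` irreducibles \<Delta> \<union> (\<lambda>i. d * a + i) ` {1..<d}" (is "irreducibles ?S = ?A \<union> ?B")
proof (intro equalityI subsetI)
  fix x assume x: "x \<in> irreducibles ?S"
  then have "x \<in> ?S" and irr: "\<And>y z. y \<in> ?S \<Longrightarrow> z \<in> ?S \<Longrightarrow> x = y + z \<Longrightarrow> y = 0 \<or> z = 0"
    and x0: "x \<noteq> 0"
    by (auto simp: irreducibles_def)
  from this(1) show "x \<in> ?A \<union> ?B"
  proof (cases rule: dilated_extension_cases)
    case (1 y)
    have "u = 0 \<or> v = 0" if "u \<in> \<Delta>" "v \<in> \<Delta>" "y = u + v" for u v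
      using irr[OF dilated_extension_mult[OF d that(1)] dilated_extension_mult[OF d that(2)]]
        that(3) 1(2) d by (simp add: distrib_left)
    then have "y \<in> irreducibles \<Delta>" using 1 x0 by (auto simp: irreducibles_def)
    then show ?thesis using 1(2) by blast
  next
    case (2 y i)
    have "0 \<in> \<Delta>" using \<Delta> by (simp add: submonoid_def)
    \<comment> \<open>The splitting used is \<open>x = d * y + (d * a + i)\<close>, whose second
      summand is positive because \<open>i \<ge> 1\<close>.\<close>
    then have "d * y = 0"
      using irr[OF dilated_extension_mult[OF d 2(1)]
          dilated_extension_residue[OF 2(3,2), of 0]] 2(2,4)
      by (auto simp: algebra_simps)
    then show ?thesis using 2 d by auto
  qed
next
  have add: "u + v \<in> \<Delta>" if "u \<in> \<Delta>" "v \<in> \<Delta>" for u v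
    using \<Delta> that by (simp add: submonoid_def)
  have "0 \<in> \<Delta>" using \<Delta> by (simp add: submonoid_def)
  fix x assume "x \<in> ?A \<union> ?B"
  then show "x \<in> irreducibles ?S"
  proof
    assume "x \<in> ?A"
    then obtain g where g: "g \<in> irreducibles \<Delta>" and x: "x = d * g" by blast
    have gD: "g \<in> \<Delta>" "g \<noteq> 0" using g by (auto simp: irreducibles_def)
    have gi: "u = 0 \<or> v = 0" if "u \<in> \<Delta>" "v \<in> \<Delta>" "g = u + v" for u v
      using g that by (simp add: irreducibles_def)
    have "y = 0 \<or> z = 0" if "y \<in> ?S" "z \<in> ?S" and xyz: "x = y + z" for y z
      using that(1)
    proof (cases rule: dilated_extension_cases)
      case (1 u)
      have "d dvd y" using 1 by simp
      then have "d dvd z" using x xyz by (metis dvd_add_right_iff dvd_triv_left)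
      then obtain v where v: "z = d * v" by blast
      then have "v \<in> \<Delta>"
        using that(2) in_dilated_extension_iff[OF d, of v] by simp
      moreover have "g = u + v" using x xyz 1(2) v d by (simp flip: distrib_left)
      ultimately show ?thesis using gi[OF 1(1)] 1(2) v by auto
    next
      case (2 u i)
      note y = this
      show ?thesis using that(2)
      proof (cases rule: dilated_extension_cases)
        case (1 v)
        then have "d * g = d * (a + u + v) + i"
          using x xyz y(4) by (simp add: algebra_simps)
        then have "(d * (a + u + v) + i) mod d = (d * g) mod d" by simp
        then have "i = 0" using y(3) by simp
        then show ?thesis using y(2) by simp
      next
        case (2 v j)
        then have eq: "d * g = d * (a + u + a + v) + (i + j)"
          using x xyz y(4) by (simp add: algebra_simps)
        \<comment> \<open>The residues sum to a multiple of \<open>d\<close> strictly between 0 and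
          \<open>2 * d\<close>, hence to \<open>d\<close>. The carry then writes \<open>g\<close> as
          a sum of two nonzero elements of \<Delta>, contradicting its irreducibility.\<close>
        then have "d dvd i + j" by (metis dvd_add_right_iff dvd_triv_left)
        then obtain k where k: "i + j = d * k" ..
        moreover have "0 < i + j" "i + j < d * 2" using y 2 by auto
        ultimately have "0 < k" "k < 2" using d by simp_all
        then have "k = 1" by linarith
        then have "i + j = d" using k by simp
        then have "d * g = d * ((a + u) + ((a + 1) + v))"
          using eq by (simp add: algebra_simps)
        then have "g = (a + u) + ((a + 1) + v)" using d by (simp only: mult_cancel1) simp
        then show ?thesis
          using gi[OF add[OF a(1) y(1)] add[OF a(2) 2(1)]] a(3) by simp
      qed
    qed
    then show ?thesis
      using x gD d dilated_extension_mult[OF d gD(1)] by (auto simp: irreducibles_def)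
  next
    assume "x \<in> ?B"
    then obtain i where i: "1 \<le> i" "i < d" and x: "x = d * a + i" 
      by (auto simp del: image_add_atLeastLessThan)
    \<comment> \<open>\<open>d * a + i\<close> is the least element of its residue class. If one
      summand is a multiple of \<open>d\<close>, the other lies in this class and is at least
      \<open>x\<close>, so the first is 0.\<close>
    have ge: "x \<le> y" if "y \<in> ?S" "y mod d = i" for y
      using that(1)
    proof (cases rule: dilated_extension_cases)
      case (1 u)
      then show ?thesis using that(2) i by simp
    next
      case (2 u j)
      then have "j = i" using that(2) by simp
      then show ?thesis using 2(4) x by (simp add: algebra_simps)
    qed
    have "y = 0 \<or> z = 0" if "y \<in> ?S" "z \<in> ?S" and xyz: "x = y + z" for y z
    proof -
      have xm: "x mod d = i" using x i by simp
      from that(1) show ?thesis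
      proof (cases rule: dilated_extension_cases)
        case (1 u)
        then have "z mod d = i" using xm xyz by simp
        then show ?thesis using ge[OF that(2)] xyz by simp
      next
        case (2 u j)
        note y = this
        show ?thesis using that(2)
        proof (cases rule: dilated_extension_cases)
          case (1 v)
          then have "y mod d = i" using xm xyz by simp
          then show ?thesis using ge[OF that(1)] xyz by simp
        next
          case (2 v k)
          \<comment> \<open>Two summands with nonzero residues add up to more than
            \<open>2 * d * a\<close>, while \<open>x < d * a + d \<le> 2 * d * a\<close>.\<close>
          have "d \<le> d * a" using a(3) by simp
          then have False using 2 y xyz x i unfolding distrib_left by linarith
          then show ?thesis ..
        qed
      qed
    qed
    then show ?thesis
      using x i dilated_extension_residue[OF i(2,1) \<open>0 \<in> \<Delta>\<close>, of a]
      by (auto simp: irreducibles_def)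
  qed
qed

lemma card_irreducibles_dilated_extension:
  assumes "submonoid \<Delta>" "0 < d" "a \<in> \<Delta>" "a + 1 \<in> \<Delta>" "a \<noteq> 0" and "finite (irreducibles \<Delta>)"
  shows "card (irreducibles (dilated_extension \<Delta> d a)) = card (irreducibles \<Delta>) + (d - 1)"
proof -
  let ?A = "(*) d ` irreducibles \<Delta>" and ?B = "(\<lambda>i. d * a + i) ` {1..<d}"
  have "?A \<inter> ?B = {}"
  proof (rule Int_emptyI)
    fix u assume u: "u \<in> ?A" "u \<in> ?B"
    have "u mod d = 0" using u(1) by (elim imageE) simp
    moreover obtain i where "1 \<le> i" "i < d" "u = d * a + i"
      using u(2) by (auto simp del: image_add_atLeastLessThan)
    ultimately show False by simp
  qed
  moreover have "card ?A = card (irreducibles \<Delta>)"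
    using assms(2) by (intro card_image) (simp add: inj_on_def)
  moreover have "card ?B = d - 1" by (simp add: card_image)
  ultimately show ?thesis
    unfolding irreducibles_dilated_extension[OF assms(1-5)]
    using assms(6) by (simp add: card_Un_disjoint)
qed

section \<open>Transfer of Wilf's inequality\<close>

theorem corollary3p6:
  fixes \<Delta> :: "nat set" and d a :: nat
  assumes "numerical_semigroup \<Delta>"
    and "\<Delta> \<noteq> UNIV"
    and "d \<ge> 2"
    and "a \<in> \<Delta> - {0}"
    and "a + 1 \<in> \<Delta>"
    and "wilf \<Delta>"
  shows "numerical_semigroup (dilated_extension \<Delta> d a) \<and> wilf (dilated_extension \<Delta> d a)"
proof -
  let ?S = "dilated_extension \<Delta> d a"
  let ?e = "card (irreducibles \<Delta>)"
  have \<Delta>: "submonoid \<Delta>" and fin: "finite (UNIV - \<Delta>)"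
    using assms(1) by (auto simp: numerical_semigroup_def)
  have d: "0 < d" and a: "a \<in> \<Delta>" "a + 1 \<in> \<Delta>" "a \<noteq> 0" using assms by auto
  define f where "f = Max (UNIV - \<Delta>)"
  have "UNIV - \<Delta> \<noteq> {}" using assms(2) by blast
  then have f: "f \<notin> \<Delta>" using Max_in[OF fin] by (auto simp: f_def)
  have f': "x \<in> \<Delta>" if "f < x" for x
    using Max_ge[OF fin, of x] that by (auto simp: f_def)
  let ?n = "card {s \<in> \<Delta>. s < Suc f}"
  let ?F = "d * (a + f) + (d - 1)"
  have S: "?F \<notin> ?S" by (rule dilated_extension_Frobenius(1)[of d f]) (use d f f' assms(3) in auto)
  have S': "x \<in> ?S" if "?F < x" for x
    by (rule dilated_extension_Frobenius(2)[of d f]) (use d f f' assms(3) that in auto)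
  \<comment> \<open>The offset \<open>d - 1\<close> in \<open>?F\<close> makes the conductor an
    exact multiple of \<open>d\<close>, as the counting lemma requires.\<close>
  have F: "Suc ?F = d * (a + Suc f)" using d by simp
  have sub: "submonoid ?S" by (rule submonoid_dilated_extension[OF \<Delta> d a(1,2)])
  have "UNIV - ?S \<subseteq> {..?F}" using S' by (auto simp: not_less[symmetric])
  then have num: "numerical_semigroup ?S"
    using sub finite_subset by (auto simp: numerical_semigroup_def)
  have "conductor \<Delta> = int (Suc f)" by (rule conductor_eqI) (use f f' in auto)
  moreover have "n_left \<Delta> = ?n" by (rule n_left_eqI) (use f f' in auto)
  ultimately have "int (?e * ?n) \<ge> int (Suc f)"
    using assms(6) embedding_dim_eq_card_irreducibles[OF \<Delta>] by (simp add: wilf_def)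
  then have wilf: "Suc f \<le> ?e * ?n" by linarith
  \<comment> \<open>The conductor of \<Delta> is positive, so Wilf's inequality excludes
    \<open>?e = 0\<close>. As \<open>card\<close> is 0 on infinite sets, this also yields finiteness
    of the irreducibles.\<close>
  then have e: "0 < ?e" by (cases ?e) auto
  then have "finite (irreducibles \<Delta>)" by (rule card_ge_0_finite)
  then have eS: "embedding_dim ?S = ?e + (d - 1)"
    unfolding embedding_dim_eq_card_irreducibles[OF sub]
    by (rule card_irreducibles_dilated_extension[OF \<Delta> d a])
  have nS: "n_left ?S = d * ?n + a"
  proof -
    have "n_left ?S = card {s \<in> ?S. s < Suc ?F}" 
      by (rule n_left_eqI) (fact S, rule S')
    also have "\<dots> = d * ?n + a"
      unfolding F by (rule card_dilated_extension_below[OF d]) (auto intro: f')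
    finally show ?thesis .
  qed
  have cS: "conductor ?S = int (d * (a + Suc f))"
    unfolding F[symmetric] by (rule conductor_eqI) (fact S, rule S')
  have "d * (a + Suc f) \<le> d * a + d * (?e * ?n)"
    using wilf by (simp only: distrib_left mult_le_mono2 add_le_cancel_left)
  \<comment> \<open>The factor \<open>?e + (d - 1)\<close> is at least \<open>d\<close>, because
    \<open>?e \<ge> 1\<close>, and at least \<open>?e\<close>; one bound is used for each
    summand.\<close>
  also have "\<dots> \<le> (?e + (d - 1)) * a + (?e + (d - 1)) * (d * ?n)"
  proof (rule add_mono)
    show "d * a \<le> (?e + (d - 1)) * a" using e d by (intro mult_le_mono1) linarith
    have "d * (?e * ?n) = ?e * (d * ?n)" by simp
    also have "\<dots> \<le> (?e + (d - 1)) * (d * ?n)" by (intro mult_le_mono1) simp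
    finally show "d * (?e * ?n) \<le> (?e + (d - 1)) * (d * ?n)" .
  qed
  also have "\<dots> = (?e + (d - 1)) * (d * ?n + a)" by (simp add: distrib_left)
  finally have "wilf ?S" unfolding wilf_def eS nS cS by (simp only: of_nat_le_iff)
  then show ?thesis using num by blast
qed

end
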